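(* Let $S$ be a numerical semigroup with multiplicity $3$ and Kunz-coordinates vector $x=(x_1,x_2)\in\mathbb{N}^2$. Then $S$ is decomposable as an intersection of pseudosymmetric numerical semigroups with multiplicity $3$ if and only if one of the following conditions holds: \begin{enumerate} \item $S$ is a $3$-pseudosymmetric numerical semigroup; \item $S$ is not $3$-irreducible, $x_1$ is even and $x_2$ is odd. \end{enumerate}
   Context: $\mathbb{N}$ denotes the set of non-negative integers. A numerical semigroup is a subset $S\subseteq\mathbb{N}$ that is closed under addition, contains $0$ and has finite complement $\mathbb{N}\setminus S$. The multiplicity of $S$ is the smallest positive integer belonging to $S$, and its Frobenius number $\mathrm{F}(S)$ is the largest integer not belonging to $S$. If $S$ has multiplicity $m$, let $w_i$ be the least element of $S$ congruent to $i$ modulo $m$, for $i=1,\dots,m-1$; the Kunz-coordinates vector of $S$ is $x=(x_1,\dots,x_{m-1})\in\mathbb{N}^{m-1}$ with $x_i=(w_i-i)/m$. A numerical semigroup is irreducible if it cannot be expressed as an intersection of two numerical semigroups containing it properly; it is pseudosymmetric if it is irreducible and $\mathrm{F}(S)$ is even. A numerical semigroup with multiplicity $m$ is $m$-irreducible if it cannot be expressed as an intersection of two numerical semigroups with multiplicity $m$ containing it properly; it is $m$-pseudosymmetric if it is $m$-irreducible and $\mathrm{F}(S)$ is even. Intersections are finite, and an intersection of a single semigroup is allowed. *)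

theory Defs
  imports "HOL-Number_Theory.Cong"
begin

definition numerical_semigroup :: "nat set \<Rightarrow> bool" where
  "numerical_semigroup S \<longleftrightarrow>
     0 \<in> S \<and> (\<forall>a\<in>S. \<forall>b\<in>S. a + b \<in> S) \<and> finite (- S)"

definition multiplicity_sg :: "nat set \<Rightarrow> nat" where
  "multiplicity_sg S = (LEAST n. 0 < n \<and> n \<in> S)"

text \<open>The Frobenius number is an integer: all negative integers lie outside \<open>S\<close>, so the
  set of all naturals has Frobenius number \<open>-1\<close>.\<close>

definition frobenius :: "nat set \<Rightarrow> int" where
  "frobenius S = (GREATEST z. z \<notin> int ` S)"

definition apery :: "nat set \<Rightarrow> nat \<Rightarrow> nat" where
  "apery S i = (LEAST w. w \<in> S \<and> [w = i] (mod multiplicity_sg S))"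

text \<open>For a numerical semigroup of multiplicity \<open>m\<close> and \<open>1 \<le> i < m\<close>, the element
  \<open>apery S i\<close> is at least \<open>i\<close> and congruent to \<open>i\<close> modulo \<open>m\<close>, so the subtraction
  below does not truncate and the division is exact.\<close>

definition kunz_coord :: "nat set \<Rightarrow> nat \<Rightarrow> nat" where
  "kunz_coord S i = (apery S i - i) div multiplicity_sg S"

definition kunz_vector :: "nat set \<Rightarrow> nat list" where
  "kunz_vector S = map (kunz_coord S) [1..<multiplicity_sg S]"

definition irreducible_sg :: "nat set \<Rightarrow> bool" where
  "irreducible_sg S \<longleftrightarrow> numerical_semigroup S \<and>
     \<not> (\<exists>S1 S2. numerical_semigroup S1 \<and> numerical_semigroup S2 \<and>
              S \<subset> S1 \<and> S \<subset> S2 \<and> S = S1 \<inter> S2)"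

definition pseudosymmetric :: "nat set \<Rightarrow> bool" where
  "pseudosymmetric S \<longleftrightarrow> irreducible_sg S \<and> even (frobenius S)"

definition m_irreducible :: "nat \<Rightarrow> nat set \<Rightarrow> bool" where
  "m_irreducible m S \<longleftrightarrow> numerical_semigroup S \<and> multiplicity_sg S = m \<and>
     \<not> (\<exists>S1 S2. numerical_semigroup S1 \<and> multiplicity_sg S1 = m \<and>
              numerical_semigroup S2 \<and> multiplicity_sg S2 = m \<and>
              S \<subset> S1 \<and> S \<subset> S2 \<and> S = S1 \<inter> S2)"

definition m_pseudosymmetric :: "nat \<Rightarrow> nat set \<Rightarrow> bool" where
  "m_pseudosymmetric m S \<longleftrightarrow> m_irreducible m S \<and> even (frobenius S)"

text \<open>The members of the family are required to be pseudosymmetric, that is, irreducible among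
  all numerical semigroups and not merely among those of multiplicity \<open>m\<close>. A one-element
  family is allowed.\<close>

definition pseudosymmetric_decomposable :: "nat \<Rightarrow> nat set \<Rightarrow> bool" where
  "pseudosymmetric_decomposable m S \<longleftrightarrow>
     (\<exists>\<T>. finite \<T> \<and> \<T> \<noteq> {} \<and>
          (\<forall>T\<in>\<T>. pseudosymmetric T \<and> multiplicity_sg T = m) \<and> S = \<Inter> \<T>)"

end

theory Submission
  imports Defs
begin

text \<open>
  A numerical semigroup of multiplicity \<open>3\<close> consists of all multiples of \<open>3\<close>, the numbers
  \<open>3 * k + 1\<close> with \<open>k \<ge> a\<close> and the numbers \<open>3 * k + 2\<close> with \<open>k \<ge> b\<close>, where \<open>(a, b)\<close> is its
  Kunz vector; the pairs that occur are those with \<open>1 \<le> a \<le> 2 * b + 1\<close> and \<open>1 \<le> b \<le> 2 * a\<close>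
  (\<open>mult3_eq_kunz3\<close>, \<open>kunz3_semigroup_iff\<close>). In these coordinates inclusion is the reversed
  componentwise order and intersection is the componentwise maximum.

  A pair is therefore a maximum of two strictly smaller admissible pairs exactly if each of its
  coordinates can be lowered by one, that is, if \<open>a < 2 * b\<close> and \<open>b + 1 < 2 * a\<close>. Among the
  remaining pairs, those with even Frobenius number form the two lines \<open>a = 2 * b\<close> and
  \<open>b + 1 = 2 * a\<close>. On these lines the gaps other than half the Frobenius number are paired with
  elements by reflection at it, which makes the semigroup irreducible without any restriction on
  the multiplicity. So for multiplicity \<open>3\<close> pseudosymmetric and \<open>3\<close>-pseudosymmetric agree, and
  the two lines describe both (\<open>kunz3_pseudosymmetric_iff\<close>).

  In an intersection of pseudosymmetric semigroups that yields the pair \<open>(a, b)\<close>, one member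
  attains the first coordinate \<open>a\<close> and one attains the second coordinate \<open>b\<close>, and these two
  already have the intersection \<open>(a, b)\<close>. If \<open>(a, b)\<close> is \<open>3\<close>-irreducible, it equals one of
  them. Otherwise the strict inequalities above exclude one of the two lines for each member: a
  member \<open>(a, d)\<close> with \<open>d \<le> b\<close> cannot satisfy \<open>d + 1 = 2 * a\<close>, so \<open>a = 2 * d\<close> is even, and a
  member \<open>(c, b)\<close> with \<open>c \<le> a\<close> cannot satisfy \<open>c = 2 * b\<close>, so \<open>b = 2 * c - 1\<close> is odd. Conversely,
  for even \<open>a\<close> and odd \<open>b\<close> these two pairs give a decomposition.
\<close>

section \<open>Kunz coordinates\<close>

lemma multiplicity_sg_in:
  assumes "numerical_semigroup S"
  shows "0 < multiplicity_sg S" "multiplicity_sg S \<in> S"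
proof -
  have "finite (- S)"
    using assms by (simp add: numerical_semigroup_def)
  then have "infinite S"
    using finite_compl[of S] by auto
  then have "\<not> S \<subseteq> {0}"
    using finite_subset[of S "{0}"] by auto
  then obtain n where "0 < n \<and> n \<in> S"
    by (auto simp: subset_iff)
  then have "0 < multiplicity_sg S \<and> multiplicity_sg S \<in> S"
    unfolding multiplicity_sg_def by (rule LeastI)
  then show "0 < multiplicity_sg S" "multiplicity_sg S \<in> S"
    by auto
qed

lemma numerical_semigroup_mult_in:
  assumes "numerical_semigroup S" "m \<in> S"
  shows "m * k \<in> S"
  using assms by (induction k) (auto simp: numerical_semigroup_def)

text \<open>A residue class modulo \<open>m\<close> meets the semigroup in an up-set, because \<open>m\<close> can be added;
  its least element is the Apery element, and the Kunz coordinate is its position in the class.\<close>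

lemma mem_iff_kunz_coord_le:
  assumes S: "numerical_semigroup S" and i: "i < multiplicity_sg S"
  shows "multiplicity_sg S * k + i \<in> S \<longleftrightarrow> kunz_coord S i \<le> k"
proof -
  define m where "m = multiplicity_sg S"
  have m: "0 < m" "m \<in> S" "i < m"
    using multiplicity_sg_in[OF S] i by (auto simp: m_def)
  obtain N where N: "\<And>n. n \<notin> S \<Longrightarrow> n < N"
  proof -
    have "finite (- S)"
      using S by (simp add: numerical_semigroup_def)
    then obtain N where "\<forall>n\<in>- S. n < N"
      using finite_nat_set_iff_bounded by blast
    then show ?thesis
      using that by blast
  qed
  have "N \<le> m * N + i"
    using m(1) by (simp add: trans_le_add1)
  then have "m * N + i \<in> S"
    using N leD by blast
  then have "m * N + i \<in> S \<and> [m * N + i = i] (mod m)"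
    by (simp add: cong_def)
  then have w: "apery S i \<in> S \<and> [apery S i = i] (mod m)"
    unfolding apery_def m_def by (rule LeastI)
  define q where "q = apery S i div m"
  have "apery S i mod m = i"
    using w m by (simp add: cong_def)
  then have wq: "apery S i = m * q + i"
    unfolding q_def by (metis mult_div_mod_eq)
  have coord: "kunz_coord S i = q"
    using m(1) by (simp add: kunz_coord_def wq m_def)
  show ?thesis
  proof
    assume "multiplicity_sg S * k + i \<in> S"
    then have "apery S i \<le> m * k + i"
      unfolding apery_def m_def by (intro Least_le) (simp add: cong_def)
    then show "kunz_coord S i \<le> k"
      using m(1) by (simp add: wq coord)
  next
    assume "kunz_coord S i \<le> k"
    then obtain j where "k = q + j"
      unfolding coord using le_Suc_ex by blast
    then have "m * k + i = apery S i + m * j"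
      by (simp add: wq algebra_simps)
    then show "multiplicity_sg S * k + i \<in> S"
      using w numerical_semigroup_mult_in[OF S m(2)] S
      by (simp add: numerical_semigroup_def m_def)
  qed
qed

section \<open>Semigroups of multiplicity three as pairs of integers\<close>

definition kunz3 :: "nat \<Rightarrow> nat \<Rightarrow> nat set" where
  "kunz3 a b = {n. (n mod 3 = 1 \<longrightarrow> a \<le> n div 3) \<and> (n mod 3 = 2 \<longrightarrow> b \<le> n div 3)}"

lemma kunz3_mem [simp]:
  "3 * k \<in> kunz3 a b"
  "Suc (3 * k) \<in> kunz3 a b \<longleftrightarrow> a \<le> k"
  "Suc (Suc (3 * k)) \<in> kunz3 a b \<longleftrightarrow> b \<le> k"
proof -
  have "Suc (3 * k) mod 3 = 1" "Suc (3 * k) div 3 = k"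
    "Suc (Suc (3 * k)) mod 3 = 2" "Suc (Suc (3 * k)) div 3 = k"
    by presburger+
  then show "3 * k \<in> kunz3 a b"
    "Suc (3 * k) \<in> kunz3 a b \<longleftrightarrow> a \<le> k"
    "Suc (Suc (3 * k)) \<in> kunz3 a b \<longleftrightarrow> b \<le> k"
    by (simp_all add: kunz3_def)
qed

lemma nat_mod3_cases:
  fixes n :: nat
  obtains k where "n = 3 * k" | k where "n = Suc (3 * k)" | k where "n = Suc (Suc (3 * k))"
proof -
  have "n = 3 * (n div 3) \<or> n = Suc (3 * (n div 3)) \<or> n = Suc (Suc (3 * (n div 3)))"
    by presburger
  then show ?thesis
    using that by blast
qed

lemma mult3_eq_kunz3:
  assumes "numerical_semigroup S" "multiplicity_sg S = 3"
  shows "S = kunz3 (kunz_coord S 1) (kunz_coord S 2)"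
proof (rule set_eqI)
  fix n
  show "n \<in> S \<longleftrightarrow> n \<in> kunz3 (kunz_coord S 1) (kunz_coord S 2)"
  proof (cases n rule: nat_mod3_cases)
    case (1 k)
    then show ?thesis
      using numerical_semigroup_mult_in[OF assms(1) multiplicity_sg_in(2)[OF assms(1)], of k]
        assms(2) by simp
  next
    case (2 k)
    then show ?thesis
      using mem_iff_kunz_coord_le[OF assms(1), of 1 k] assms(2) by simp
  next
    case (3 k)
    then show ?thesis
      using mem_iff_kunz_coord_le[OF assms(1), of 2 k] assms(2) by simp
  qed
qed

lemma kunz3_subset_iff: "kunz3 a b \<subseteq> kunz3 c d \<longleftrightarrow> c \<le> a \<and> d \<le> b"
proof
  assume sub: "kunz3 a b \<subseteq> kunz3 c d"
  show "c \<le> a \<and> d \<le> b"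
    using subsetD[OF sub, of "Suc (3 * a)"] subsetD[OF sub, of "Suc (Suc (3 * b))"] by simp
next
  assume le: "c \<le> a \<and> d \<le> b"
  show "kunz3 a b \<subseteq> kunz3 c d"
  proof
    fix n assume "n \<in> kunz3 a b"
    then show "n \<in> kunz3 c d"
      using le by (cases n rule: nat_mod3_cases) simp_all
  qed
qed

lemma kunz3_eq_iff: "kunz3 a b = kunz3 c d \<longleftrightarrow> a = c \<and> b = d"
  unfolding set_eq_subset kunz3_subset_iff by auto

lemma kunz3_Int: "kunz3 a b \<inter> kunz3 c d = kunz3 (max a c) (max b d)"
proof (rule set_eqI)
  fix n
  show "n \<in> kunz3 a b \<inter> kunz3 c d \<longleftrightarrow> n \<in> kunz3 (max a c) (max b d)"
    by (cases n rule: nat_mod3_cases) simp_all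
qed

text \<open>The two upper bounds say that twice an element of one nonzero residue class, which lies in
  the other class, is not below the least element there: \<open>2 * (3 * a + 1) = 3 * (2 * a) + 2\<close> and
  \<open>2 * (3 * b + 2) = 3 * (2 * b + 1) + 1\<close>. The lower bounds keep \<open>1\<close> and \<open>2\<close> out.\<close>

lemma kunz3_semigroup_iff:
  "numerical_semigroup (kunz3 a b) \<and> multiplicity_sg (kunz3 a b) = 3 \<longleftrightarrow>
     1 \<le> a \<and> a \<le> 2 * b + 1 \<and> 1 \<le> b \<and> b \<le> 2 * a"
proof (intro iffI conjI)
  assume *: "numerical_semigroup (kunz3 a b) \<and> multiplicity_sg (kunz3 a b) = 3"
  then have add: "\<And>x y. x \<in> kunz3 a b \<Longrightarrow> y \<in> kunz3 a b \<Longrightarrow> x + y \<in> kunz3 a b"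
    by (auto simp: numerical_semigroup_def)
  have least: "n \<notin> kunz3 a b" if "0 < n" "n < 3" for n
    using * that not_less_Least[of n "\<lambda>n. 0 < n \<and> n \<in> kunz3 a b"]
    by (simp add: multiplicity_sg_def)
  show "1 \<le> a"
    using least[of 1] kunz3_mem(2)[of 0 a b] by simp
  show "1 \<le> b"
    using least[of 2] kunz3_mem(3)[of 0 a b] by (simp add: numeral_2_eq_2)
  have "Suc (3 * a) + Suc (3 * a) = Suc (Suc (3 * (2 * a)))"
    by simp
  then show "b \<le> 2 * a"
    using add[of "Suc (3 * a)" "Suc (3 * a)"] by (simp only: kunz3_mem order_refl simp_thms)
  have "Suc (Suc (3 * b)) + Suc (Suc (3 * b)) = Suc (3 * (2 * b + 1))"
    by simp
  then show "a \<le> 2 * b + 1"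
    using add[of "Suc (Suc (3 * b))" "Suc (Suc (3 * b))"]
    by (simp only: kunz3_mem order_refl simp_thms)
next
  assume *: "1 \<le> a \<and> a \<le> 2 * b + 1 \<and> 1 \<le> b \<and> b \<le> 2 * a"
  have "- kunz3 a b \<subseteq> {..<3 * (a + b) + 3}"
  proof
    fix n assume "n \<in> - kunz3 a b"
    then show "n \<in> {..<3 * (a + b) + 3}"
      by (cases n rule: nat_mod3_cases) simp_all
  qed
  then have "finite (- kunz3 a b)"
    by (rule finite_subset) simp
  moreover have "x + y \<in> kunz3 a b" if x: "x \<in> kunz3 a b" and y: "y \<in> kunz3 a b" for x y
  proof -
    have xy: "(x mod 3 = 1 \<longrightarrow> a \<le> x div 3) \<and> (x mod 3 = 2 \<longrightarrow> b \<le> x div 3)"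
      "(y mod 3 = 1 \<longrightarrow> a \<le> y div 3) \<and> (y mod 3 = 2 \<longrightarrow> b \<le> y div 3)"
      using x y by (simp_all add: kunz3_def)
    have "(x + y) div 3 = x div 3 + y div 3 + (x mod 3 + y mod 3) div 3"
      by (rule div_add1_eq)
    moreover have "(x + y) mod 3 = (x mod 3 + y mod 3) mod 3"
      by (simp add: mod_add_eq)
    moreover have "x mod 3 = 0 \<or> x mod 3 = 1 \<or> x mod 3 = 2"
      "y mod 3 = 0 \<or> y mod 3 = 1 \<or> y mod 3 = 2"
      by auto
    ultimately have "((x + y) mod 3 = 1 \<longrightarrow> a \<le> (x + y) div 3) \<and>
        ((x + y) mod 3 = 2 \<longrightarrow> b \<le> (x + y) div 3)"
      using xy * by (elim disjE) simp_all
    then show ?thesis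
      by (simp add: kunz3_def)
  qed
  ultimately show "numerical_semigroup (kunz3 a b)"
    using kunz3_mem(1)[of 0] by (simp add: numerical_semigroup_def)
  show "multiplicity_sg (kunz3 a b) = 3"
    unfolding multiplicity_sg_def
  proof (rule Least_equality)
    show "0 < (3::nat) \<and> 3 \<in> kunz3 a b"
      using kunz3_mem(1)[of 1] by simp
  next
    fix n assume n: "0 < n \<and> n \<in> kunz3 a b"
    show "3 \<le> n"
    proof (rule ccontr)
      assume "\<not> 3 \<le> n"
      with n have "n = Suc (3 * 0) \<or> n = Suc (Suc (3 * 0))"
        by auto
      then show False
        using n * kunz3_mem(2,3)[of 0 a b] by auto
    qed
  qed
qed

lemma mult3_obtain:
  assumes "numerical_semigroup S" "multiplicity_sg S = 3"
  obtains a b where "S = kunz3 a b" "1 \<le> a" "a \<le> 2 * b + 1" "1 \<le> b" "b \<le> 2 * a"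
proof -
  define a b where "a = kunz_coord S 1" and "b = kunz_coord S 2"
  have S: "S = kunz3 a b"
    using mult3_eq_kunz3[OF assms] by (simp add: a_def b_def)
  then have "numerical_semigroup (kunz3 a b) \<and> multiplicity_sg (kunz3 a b) = 3"
    using assms by simp
  then show ?thesis
    using that[OF S] unfolding kunz3_semigroup_iff by blast
qed

section \<open>Irreducibility\<close>

text \<open>If the pair is a maximum of two strictly smaller admissible ones, one of these keeps \<open>a\<close> and
  lowers \<open>b\<close>, and the other one keeps \<open>b\<close> and lowers \<open>a\<close>. By monotonicity of the bounds it
  suffices to lower by one. The bound \<open>a \<le> 2 * b + 1\<close> survives in the first pair unless
  \<open>2 * b \<le> a\<close>, and \<open>b \<le> 2 * a\<close> survives in the second one unless \<open>2 * a \<le> b + 1\<close>; if both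
  survive, then \<open>a\<close> and \<open>b\<close> are at least \<open>2\<close>, so both pairs are positive.\<close>

lemma kunz3_m_irreducible_iff:
  assumes "1 \<le> a" "a \<le> 2 * b + 1" "1 \<le> b" "b \<le> 2 * a"
  shows "m_irreducible 3 (kunz3 a b) \<longleftrightarrow> 2 * b \<le> a \<or> 2 * a \<le> b + 1"
proof
  assume irr: "m_irreducible 3 (kunz3 a b)"
  show "2 * b \<le> a \<or> 2 * a \<le> b + 1"
  proof (rule ccontr)
    assume *: "\<not> (2 * b \<le> a \<or> 2 * a \<le> b + 1)"
    have "numerical_semigroup (kunz3 (a - 1) b) \<and> multiplicity_sg (kunz3 (a - 1) b) = 3"
      "numerical_semigroup (kunz3 a (b - 1)) \<and> multiplicity_sg (kunz3 a (b - 1)) = 3"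
      unfolding kunz3_semigroup_iff using assms * by auto
    moreover have "kunz3 a b = kunz3 (a - 1) b \<inter> kunz3 a (b - 1)"
      by (simp add: kunz3_Int)
    moreover have "kunz3 a b \<subset> kunz3 (a - 1) b" "kunz3 a b \<subset> kunz3 a (b - 1)"
      using assms by (auto simp: less_le kunz3_subset_iff kunz3_eq_iff)
    ultimately show False
      using irr unfolding m_irreducible_def by blast
  qed
next
  assume *: "2 * b \<le> a \<or> 2 * a \<le> b + 1"
  have False if S1: "numerical_semigroup S1" "multiplicity_sg S1 = 3"
    and S2: "numerical_semigroup S2" "multiplicity_sg S2 = 3"
    and less: "kunz3 a b \<subset> S1" "kunz3 a b \<subset> S2" and eq: "kunz3 a b = S1 \<inter> S2" for S1 S2
  proof -
    obtain c d where 1: "S1 = kunz3 c d" "1 \<le> c" "c \<le> 2 * d + 1" "1 \<le> d" "d \<le> 2 * c"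
      using mult3_obtain[OF S1] .
    obtain e f where 2: "S2 = kunz3 e f" "1 \<le> e" "e \<le> 2 * f + 1" "1 \<le> f" "f \<le> 2 * e"
      using mult3_obtain[OF S2] .
    have "a = max c e" "b = max d f" "c < a \<or> d < b" "e < a \<or> f < b"
      using less eq unfolding 1(1) 2(1) less_le kunz3_Int kunz3_subset_iff kunz3_eq_iff
      by auto
    then show False
      using 1 2 * by linarith
  qed
  then show "m_irreducible 3 (kunz3 a b)"
    using assms kunz3_semigroup_iff unfolding m_irreducible_def by blast
qed

lemma irreducible_sg_imp_m_irreducible:
  assumes "irreducible_sg S" "multiplicity_sg S = m"
  shows "m_irreducible m S"
  using assms unfolding irreducible_sg_def m_irreducible_def by blast

text \<open>Under the reflection \<open>n \<mapsto> f - n\<close>, a proper oversemigroup must contain \<open>f\<close>: a new element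
  \<open>n\<close> is complemented to \<open>f\<close> by an old one, or it is \<open>f / 2\<close> and is doubled. Two proper
  oversemigroups thus share \<open>f\<close>.\<close>

lemma irreducible_sg_if_reflection:
  assumes S: "numerical_semigroup S" and f: "f \<notin> S"
    and refl: "\<And>n. n \<notin> S \<Longrightarrow> 2 * n = f \<or> (\<exists>s\<in>S. n + s = f)"
  shows "irreducible_sg S"
proof -
  have "f \<in> T" if T: "numerical_semigroup T" and less: "S \<subset> T" for T
  proof -
    obtain n where n: "n \<in> T" "n \<notin> S"
      using less by blast
    have add: "\<And>x y. x \<in> T \<Longrightarrow> y \<in> T \<Longrightarrow> x + y \<in> T"
      using T by (auto simp: numerical_semigroup_def)
    show ?thesis
      using refl[OF n(2)] add[OF n(1) n(1)] add[OF n(1)] less by (auto simp: mult_2)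
  qed
  then show ?thesis
    using S f unfolding irreducible_sg_def by blast
qed

section \<open>Pseudosymmetry\<close>

lemma frobenius_kunz3:
  assumes "1 \<le> a" "1 \<le> b"
  shows "frobenius (kunz3 a b) = max (3 * int a - 2) (3 * int b - 1)"
  unfolding frobenius_def
proof (rule Greatest_equality)
  have "Suc (3 * (a - 1)) \<notin> kunz3 a b" "Suc (Suc (3 * (b - 1))) \<notin> kunz3 a b"
    using assms by auto
  then have "int (Suc (3 * (a - 1))) \<notin> int ` kunz3 a b"
    "int (Suc (Suc (3 * (b - 1)))) \<notin> int ` kunz3 a b"
    by (simp_all only: inj_image_mem_iff[OF inj_of_nat] not_False_eq_True)
  moreover have "int (Suc (3 * (a - 1))) = 3 * int a - 2"
    "int (Suc (Suc (3 * (b - 1)))) = 3 * int b - 1"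
    using assms by (auto simp: of_nat_diff)
  ultimately show "max (3 * int a - 2) (3 * int b - 1) \<notin> int ` kunz3 a b"
    by (simp add: max_def)
next
  fix z assume z: "z \<notin> int ` kunz3 a b"
  show "z \<le> max (3 * int a - 2) (3 * int b - 1)"
  proof (cases "z < 0")
    case True
    then show ?thesis
      using assms by auto
  next
    case False
    then obtain n where n: "z = int n"
      by (metis nonneg_int_cases not_less)
    then have "n \<notin> kunz3 a b"
      using z by blast
    then show ?thesis
      unfolding n by (cases n rule: nat_mod3_cases) auto
  qed
qed

text \<open>On the line \<open>a = 2 * b\<close> the reflection is at the Frobenius number \<open>6 * b - 2\<close>, whose half
  \<open>3 * b - 1\<close> is the largest gap congruent to \<open>2\<close>.\<close>

lemma kunz3_irreducible_first_line:
  assumes "1 \<le> b"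
  shows "irreducible_sg (kunz3 (2 * b) b)"
proof (rule irreducible_sg_if_reflection[where f = "Suc (3 * (2 * b - 1))"])
  show "numerical_semigroup (kunz3 (2 * b) b)"
    using assms kunz3_semigroup_iff[of "2 * b" b] by auto
  show "Suc (3 * (2 * b - 1)) \<notin> kunz3 (2 * b) b"
    using assms by auto
  fix n assume n: "n \<notin> kunz3 (2 * b) b"
  show "2 * n = Suc (3 * (2 * b - 1)) \<or> (\<exists>s\<in>kunz3 (2 * b) b. n + s = Suc (3 * (2 * b - 1)))"
  proof (cases n rule: nat_mod3_cases)
    case (1 k)
    then show ?thesis
      using n by simp
  next
    case (2 k)
    then have "n + 3 * (2 * b - 1 - k) = Suc (3 * (2 * b - 1))"
      using n by auto
    then show ?thesis
      using kunz3_mem(1) by blast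
  next
    case (3 k)
    then have k: "k < b"
      using n by simp
    show ?thesis
    proof (cases "k = b - 1")
      case True
      then show ?thesis
        using 3 k by auto
    next
      case False
      have "n + Suc (Suc (3 * (2 * b - 2 - k))) = Suc (3 * (2 * b - 1))"
        using 3 k False by auto
      moreover have "Suc (Suc (3 * (2 * b - 2 - k))) \<in> kunz3 (2 * b) b"
        using k False by (subst kunz3_mem) auto
      ultimately show ?thesis
        by blast
    qed
  qed
qed

text \<open>On the line \<open>b = 2 * a - 1\<close> the reflection is at the Frobenius number \<open>6 * a - 4\<close>, whose half
  \<open>3 * a - 2\<close> is the largest gap congruent to \<open>1\<close>.\<close>

lemma kunz3_irreducible_second_line:
  assumes "1 \<le> a"
  shows "irreducible_sg (kunz3 a (2 * a - 1))"
proof (rule irreducible_sg_if_reflection[where f = "Suc (Suc (3 * (2 * a - 2)))"])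
  show "numerical_semigroup (kunz3 a (2 * a - 1))"
    using assms kunz3_semigroup_iff[of a "2 * a - 1"] by auto
  show "Suc (Suc (3 * (2 * a - 2))) \<notin> kunz3 a (2 * a - 1)"
    using assms by (subst kunz3_mem) auto
  fix n assume n: "n \<notin> kunz3 a (2 * a - 1)"
  show "2 * n = Suc (Suc (3 * (2 * a - 2))) \<or>
    (\<exists>s\<in>kunz3 a (2 * a - 1). n + s = Suc (Suc (3 * (2 * a - 2))))"
  proof (cases n rule: nat_mod3_cases)
    case (1 k)
    then show ?thesis
      using n by simp
  next
    case (3 k)
    then have "n + 3 * (2 * a - 2 - k) = Suc (Suc (3 * (2 * a - 2)))"
      using n by auto
    then show ?thesis
      using kunz3_mem(1) by blast
  next
    case (2 k)
    then have k: "k < a"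
      using n by simp
    show ?thesis
    proof (cases "k = a - 1")
      case True
      then show ?thesis
        using 2 k by auto
    next
      case False
      have "n + Suc (3 * (2 * a - 2 - k)) = Suc (Suc (3 * (2 * a - 2)))"
        using 2 k False by auto
      moreover have "Suc (3 * (2 * a - 2 - k)) \<in> kunz3 a (2 * a - 1)"
        using k False by (subst kunz3_mem) auto
      ultimately show ?thesis
        by blast
    qed
  qed
qed

text \<open>Of the four lines \<open>a = 2 * b\<close>, \<open>a = 2 * b + 1\<close>, \<open>b + 1 = 2 * a\<close>, \<open>b = 2 * a\<close> that
  \<open>3\<close>-irreducibility allows, the parity of the Frobenius number selects the first and the third.\<close>

lemma kunz3_m_pseudosymmetric_iff:
  assumes "1 \<le> a" "a \<le> 2 * b + 1" "1 \<le> b" "b \<le> 2 * a"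
  shows "m_pseudosymmetric 3 (kunz3 a b) \<longleftrightarrow> a = 2 * b \<or> b + 1 = 2 * a"
proof -
  have *: "m_pseudosymmetric 3 (kunz3 a b) \<longleftrightarrow>
    (2 * b \<le> a \<or> 2 * a \<le> b + 1) \<and> even (max (3 * int a - 2) (3 * int b - 1))"
    using assms by (simp add: m_pseudosymmetric_def kunz3_m_irreducible_iff frobenius_kunz3)
  consider "a = 2 * b" | "a = 2 * b + 1" | "b = 2 * a" | "b + 1 = 2 * a"
    | "a < 2 * b" "b + 1 < 2 * a"
    using assms by linarith
  then show ?thesis
  proof cases
    case 1
    then have "max (3 * int a - 2) (3 * int b - 1) = 2 * (3 * int b - 1)"
      using assms by simp
    then show ?thesis
      unfolding * using 1 by simp
  next
    case 2
    then have "max (3 * int a - 2) (3 * int b - 1) = 2 * (3 * int b) + 1"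
      using assms by simp
    then show ?thesis
      unfolding * using 2 assms by simp
  next
    case 3
    then have "max (3 * int a - 2) (3 * int b - 1) = 2 * (3 * int a - 1) + 1"
      using assms by simp
    then show ?thesis
      unfolding * using 3 assms by simp
  next
    case 4
    then have b: "int b = 2 * int a - 1"
      by linarith
    then have "max (3 * int a - 2) (3 * int b - 1) = 2 * (3 * int a - 2)"
      using assms by simp
    then have "even (max (3 * int a - 2) (3 * int b - 1))"
      by (simp only: dvd_triv_left)
    then show ?thesis
      unfolding * using 4 by (simp only: order_refl simp_thms)
  next
    case 5
    then show ?thesis
      unfolding * by simp
  qed
qed

lemma kunz3_pseudosymmetric_iff:
  assumes "1 \<le> a" "a \<le> 2 * b + 1" "1 \<le> b" "b \<le> 2 * a"
  shows "pseudosymmetric (kunz3 a b) \<longleftrightarrow> a = 2 * b \<or> b + 1 = 2 * a"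
proof
  assume "pseudosymmetric (kunz3 a b)"
  then have "m_pseudosymmetric 3 (kunz3 a b)"
    using irreducible_sg_imp_m_irreducible assms kunz3_semigroup_iff
    unfolding pseudosymmetric_def m_pseudosymmetric_def by blast
  then show "a = 2 * b \<or> b + 1 = 2 * a"
    using kunz3_m_pseudosymmetric_iff[OF assms] by simp
next
  assume *: "a = 2 * b \<or> b + 1 = 2 * a"
  then have "even (frobenius (kunz3 a b))"
    using kunz3_m_pseudosymmetric_iff[OF assms] by (simp add: m_pseudosymmetric_def)
  moreover have "irreducible_sg (kunz3 a b)"
    using *
  proof
    assume "a = 2 * b"
    then show ?thesis
      using kunz3_irreducible_first_line assms by simp
  next
    assume "b + 1 = 2 * a"
    then have "b = 2 * a - 1"
      by simp
    then show ?thesis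
      using kunz3_irreducible_second_line assms by simp
  qed
  ultimately show "pseudosymmetric (kunz3 a b)"
    by (simp add: pseudosymmetric_def)
qed

section \<open>Decomposition into pseudosymmetric semigroups\<close>

lemma mult3_pseudosymmetric_obtain:
  assumes "pseudosymmetric T" "multiplicity_sg T = 3"
  obtains c d where "T = kunz3 c d" "1 \<le> c" "1 \<le> d" "c = 2 * d \<or> d + 1 = 2 * c"
proof -
  have "numerical_semigroup T"
    using assms by (simp add: pseudosymmetric_def irreducible_sg_def)
  then obtain c d where "T = kunz3 c d" "1 \<le> c" "c \<le> 2 * d + 1" "1 \<le> d" "d \<le> 2 * c"
    using mult3_obtain assms(2) by blast
  then show ?thesis
    using that kunz3_pseudosymmetric_iff assms(1) by blast
qed

text \<open>The largest gap in a nonzero residue class is missing from some member of the family, and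
  that member then has the same Kunz coordinate for this class.\<close>

lemma kunz3_decomposable_coordinates:
  assumes "pseudosymmetric_decomposable 3 (kunz3 a b)" "1 \<le> a" "1 \<le> b"
  shows "\<exists>d. 1 \<le> d \<and> d \<le> b \<and> (a = 2 * d \<or> d + 1 = 2 * a)"
    and "\<exists>c. 1 \<le> c \<and> c \<le> a \<and> (c = 2 * b \<or> b + 1 = 2 * c)"
proof -
  obtain \<T> where \<T>: "\<And>T. T \<in> \<T> \<Longrightarrow> pseudosymmetric T \<and> multiplicity_sg T = 3"
    "kunz3 a b = \<Inter> \<T>"
    using assms(1) unfolding pseudosymmetric_decomposable_def by blast
  have "Suc (3 * (a - 1)) \<notin> \<Inter> \<T>"
    unfolding \<T>(2)[symmetric] using assms by auto
  then obtain T where T: "T \<in> \<T>" "Suc (3 * (a - 1)) \<notin> T"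
    by blast
  obtain c d where cd: "T = kunz3 c d" "1 \<le> c" "1 \<le> d" "c = 2 * d \<or> d + 1 = 2 * c"
    using mult3_pseudosymmetric_obtain \<T>(1)[OF T(1)] by blast
  have "c \<le> a" "d \<le> b"
    using \<T>(2) T(1) cd(1) kunz3_subset_iff by blast+
  moreover have "a \<le> c"
    using T(2) by (simp add: cd(1))
  ultimately show "\<exists>d. 1 \<le> d \<and> d \<le> b \<and> (a = 2 * d \<or> d + 1 = 2 * a)"
    using cd by auto
  have "Suc (Suc (3 * (b - 1))) \<notin> \<Inter> \<T>"
    unfolding \<T>(2)[symmetric] using assms by auto
  then obtain T where T: "T \<in> \<T>" "Suc (Suc (3 * (b - 1))) \<notin> T"
    by blast
  obtain c d where cd: "T = kunz3 c d" "1 \<le> c" "1 \<le> d" "c = 2 * d \<or> d + 1 = 2 * c"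
    using mult3_pseudosymmetric_obtain \<T>(1)[OF T(1)] by blast
  have "c \<le> a" "d \<le> b"
    using \<T>(2) T(1) cd(1) kunz3_subset_iff by blast+
  moreover have "b \<le> d"
    using T(2) by (simp add: cd(1))
  ultimately show "\<exists>c. 1 \<le> c \<and> c \<le> a \<and> (c = 2 * b \<or> b + 1 = 2 * c)"
    using cd by auto
qed

lemma kunz3_decomposable_iff:
  assumes adm: "1 \<le> a" "a \<le> 2 * b + 1" "1 \<le> b" "b \<le> 2 * a"
  shows "pseudosymmetric_decomposable 3 (kunz3 a b) \<longleftrightarrow>
    (a = 2 * b \<or> b + 1 = 2 * a) \<or> (a < 2 * b \<and> b + 1 < 2 * a \<and> even a \<and> odd b)"
proof
  assume dec: "pseudosymmetric_decomposable 3 (kunz3 a b)"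
  obtain d where d: "1 \<le> d" "d \<le> b" "a = 2 * d \<or> d + 1 = 2 * a"
    using kunz3_decomposable_coordinates(1)[OF dec adm(1,3)] by blast
  obtain c where c: "1 \<le> c" "c \<le> a" "c = 2 * b \<or> b + 1 = 2 * c"
    using kunz3_decomposable_coordinates(2)[OF dec adm(1,3)] by blast
  show "(a = 2 * b \<or> b + 1 = 2 * a) \<or> (a < 2 * b \<and> b + 1 < 2 * a \<and> even a \<and> odd b)"
  proof (cases "a = 2 * b \<or> b + 1 = 2 * a")
    case False
    have "b + 1 = 2 * c"
    proof (rule ccontr)
      assume "b + 1 \<noteq> 2 * c"
      then have "a = 2 * b + 1"
        using False adm c by linarith
      then show False
        using False adm d by presburger
    qed
    moreover have "a = 2 * d"
    proof (rule ccontr)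
      assume "a \<noteq> 2 * d"
      then have "b = 2 * a"
        using False adm d by linarith
      then show False
        using \<open>b + 1 = 2 * c\<close> by presburger
    qed
    ultimately have "a \<le> 2 * b" "b + 1 \<le> 2 * a" "even a" "even (b + 1)"
      using c d by auto
    then show ?thesis
      using False by auto
  qed simp
next
  assume *: "(a = 2 * b \<or> b + 1 = 2 * a) \<or> (a < 2 * b \<and> b + 1 < 2 * a \<and> even a \<and> odd b)"
  \<comment> \<open>On either line the semigroup is its own decomposition; otherwise the two semigroups below
    attain one coordinate each.\<close>
  show "pseudosymmetric_decomposable 3 (kunz3 a b)"
  proof (cases "a = 2 * b \<or> b + 1 = 2 * a")
    case True
    then have "pseudosymmetric (kunz3 a b)" "multiplicity_sg (kunz3 a b) = 3"
      using kunz3_pseudosymmetric_iff[OF adm] kunz3_semigroup_iff adm by blast+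
    then show ?thesis
      unfolding pseudosymmetric_decomposable_def by (intro exI[of _ "{kunz3 a b}"]) auto
  next
    case False
    obtain d where d: "a = 2 * d"
      using * False by blast
    obtain c where c: "b + 1 = 2 * c"
      using * False by (metis even_plus_one_iff dvdE)
    have adm1: "1 \<le> a \<and> a \<le> 2 * d + 1 \<and> 1 \<le> d \<and> d \<le> 2 * a"
      and adm2: "1 \<le> c \<and> c \<le> 2 * b + 1 \<and> 1 \<le> b \<and> b \<le> 2 * c"
      and le: "d \<le> b" "c \<le> a"
      using adm c d * False by auto
    have "pseudosymmetric (kunz3 a d)" "pseudosymmetric (kunz3 c b)"
      using kunz3_pseudosymmetric_iff adm1 adm2 c d by blast+
    moreover have "multiplicity_sg (kunz3 a d) = 3" "multiplicity_sg (kunz3 c b) = 3"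
      using kunz3_semigroup_iff adm1 adm2 by blast+
    moreover have "kunz3 a b = \<Inter> {kunz3 a d, kunz3 c b}"
      using le by (simp add: kunz3_Int max_def)
    ultimately show ?thesis
      unfolding pseudosymmetric_decomposable_def
      by (intro exI[of _ "{kunz3 a d, kunz3 c b}"]) auto
  qed
qed

theorem corollary19:
  fixes S :: "nat set" and x1 x2 :: nat
  assumes "numerical_semigroup S"
    and "multiplicity_sg S = 3"
    and "kunz_vector S = [x1, x2]"
  shows "pseudosymmetric_decomposable 3 S \<longleftrightarrow>
           m_pseudosymmetric 3 S \<or> (\<not> m_irreducible 3 S \<and> even x1 \<and> odd x2)"
proof -
  have "kunz_coord S 1 = x1" "kunz_coord S 2 = x2"
    using assms(2,3) by (simp_all add: kunz_vector_def upt_rec numeral_2_eq_2)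
  then have S: "S = kunz3 x1 x2"
    using mult3_eq_kunz3[OF assms(1,2)] by simp
  then have adm: "1 \<le> x1" "x1 \<le> 2 * x2 + 1" "1 \<le> x2" "x2 \<le> 2 * x1"
    using kunz3_semigroup_iff assms(1,2) by auto
  show ?thesis
    unfolding S kunz3_decomposable_iff[OF adm] kunz3_m_pseudosymmetric_iff[OF adm]
      kunz3_m_irreducible_iff[OF adm] by auto
qed

end
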